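(* Let $n\ge2$ and let $A_1,\dots,A_m\in\mathbb{S}^n$ satisfy $\operatorname{tr}A_i=0$ and $\operatorname{tr}(A_iA_j)=\delta_{ij}$ for all $i,j=1,\dots,m$. Let $\mathbf{b}\in\operatorname{int}\mathscr{M}$, let $\delta:=\operatorname{dist}(\mathbf{b},\partial\mathscr{M})>0$, and let $f(\mathbf{y})=\log\operatorname{tr}\exp A(\mathbf{y})-\mathbf{b}^T\mathbf{y}$. Let $(\mathbf{y}_k)_{k\ge0}$ be generated from $\mathbf{y}_0\in\mathbb{R}^m$ by the gradient method $\mathbf{y}_{k+1}=\mathbf{y}_k-2\nabla f(\mathbf{y}_k)$. Given $\epsilon>0$, the bound $\|\nabla f(\mathbf{y}_k)\|_2\le\epsilon$ holds whenever $$k\ge n\,e^{\sqrt2\,f(\mathbf{y}_0)/\delta}\,\log\frac{\sqrt{f(\mathbf{y}_0)}}{\epsilon}.$$ In particular, for $\mathbf{y}_0=0$, where $f(0)=\log n$, it holds whenever $$k\ge n^{1+\sqrt2/\delta}\,\log\frac{\sqrt{\log n}}{\epsilon}.$$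
   Context: $\mathbb{S}^n$ is the space of real symmetric $n\times n$ matrices, and $\mathbb{S}^n_1=\{X\in\mathbb{S}^n: X\succeq 0,\ \operatorname{tr}X=1\}$. $\delta_{ij}$ equals $1$ if $i=j$ and $0$ otherwise. $A(\mathbf{y})=\sum_{i=1}^m y_iA_i$, $\mathcal{A}(X)=(\operatorname{tr}(A_iX))_{i=1,\dots,m}$, and the moment body is $\mathscr{M}=\mathcal{A}(\mathbb{S}^n_1)\subset\mathbb{R}^m$, with boundary $\partial\mathscr{M}$ and interior $\operatorname{int}\mathscr{M}$ in $\mathbb{R}^m$; distances are Euclidean. The gradient of $f$ is $\nabla f(\mathbf{y})=\mathcal{A}(X(\mathbf{y}))-\mathbf{b}$ with $X(\mathbf{y})=\exp A(\mathbf{y})/\operatorname{tr}\exp A(\mathbf{y})$. *)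

theory Defs
  imports "HOL-Analysis.Analysis"
begin

(* The type real^'n^'n carries the componentwise product, so powers and the exponential
   of a matrix are defined here with respect to the matrix product **. *)

primrec mat_power :: "real^'n^'n \<Rightarrow> nat \<Rightarrow> real^'n^'n" where
  "mat_power X 0 = mat 1"
| "mat_power X (Suc k) = X ** mat_power X k"

definition mat_exp :: "real^'n^'n \<Rightarrow> real^'n^'n" where
  "mat_exp X = (\<Sum>k. (1 / fact k) *\<^sub>R mat_power X k)"

definition symmetric_mat :: "real^'n^'n \<Rightarrow> bool" where
  "symmetric_mat X \<longleftrightarrow> transpose X = X"

definition psd :: "real^'n^'n \<Rightarrow> bool" where
  "psd X \<longleftrightarrow> symmetric_mat X \<and> (\<forall>v. 0 \<le> v \<bullet> (X *v v))"

definition spectraplex :: "(real^'n^'n) set" where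
  "spectraplex = {X. psd X \<and> trace X = 1}"

definition lin_pencil :: "('m \<Rightarrow> real^'n^'n) \<Rightarrow> real^'m \<Rightarrow> real^'n^'n" where
  "lin_pencil A y = (\<Sum>i\<in>UNIV. (y $ i) *\<^sub>R A i)"

definition moment_map :: "('m \<Rightarrow> real^'n^'n) \<Rightarrow> real^'n^'n \<Rightarrow> real^'m" where
  "moment_map A X = (\<chi> i. trace (A i ** X))"

definition moment_body :: "('m \<Rightarrow> real^'n^'n) \<Rightarrow> (real^'m) set" where
  "moment_body A = moment_map A ` spectraplex"

definition potential :: "('m \<Rightarrow> real^'n^'n) \<Rightarrow> real^'m \<Rightarrow> real^'m \<Rightarrow> real" where
  "potential A b y = ln (trace (mat_exp (lin_pencil A y))) - b \<bullet> y"

definition gradient :: "('a::real_inner \<Rightarrow> real) \<Rightarrow> 'a \<Rightarrow> 'a" where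
  "gradient f x = (THE D. GDERIV f x :> D)"

end

theory Submission
  imports Defs
begin

text \<open>
The potential \<open>f\<close> is convex, and the gradient method with step \<open>1 / L\<close> converges linearly once \<open>f\<close> is
known to be \<open>L\<close>-smooth with \<open>L = 1 / 2\<close> and strongly convex on its initial sublevel set. Both facts
concern the gap
\<open>f z - f y - \<nabla>f(y) \<bullet> (z - y)\<close>,
which is the relative entropy between the Gibbs states \<open>X(y)\<close> and \<open>X(z)\<close>. Diagonalizing \<open>A(y)\<close> and
\<open>A(z)\<close> separately, with eigenframes \<open>u\<close> and \<open>v\<close>, turns it into a double sum of tangent gaps of the
scalar exponential function with the weights \<open>(u i \<bullet> v j)\<^sup>2\<close> (\<open>bregman_double_sum\<close>). Scalar
inequalities then give both bounds. They also squeeze the gap to second order in \<open>z - y\<close>, which is how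
\<open>f\<close> is seen to be differentiable with the expected gradient (\<open>gradient_potential\<close>).

Strong convexity (\<open>bregman_ge_norm\<close>): if both Gibbs states have their eigenvalues above \<open>\<mu>\<close>, the
scalar gaps are at least \<open>\<mu> / 2\<close> times the squared differences of the logarithmic eigenvalues, and
these sum to at least \<open>\<parallel>z - y\<parallel>\<^sup>2\<close>.

Smoothness (\<open>bregman_le_spread\<close>): the gaps in the two directions sum to \<open>tr ((X(z) - X(y)) H)\<close>, where
\<open>H = A(z) - A(y)\<close>. A lower bound of Pinsker type for one of them, obtained summand by summand, leaves
at most \<open>\<parallel>H\<parallel>\<^sup>2 / 4\<close> for the other. This uses that \<open>H\<close>, shifted by the midpoint of its spectrum, has
operator norm at most \<open>\<parallel>H\<parallel> / \<surd>2\<close>.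

Finally, \<open>b\<close> has distance \<open>\<delta>\<close> from the boundary of the moment body, which forces
\<open>f y \<ge> \<delta> \<parallel>y\<parallel>\<close> (\<open>potential_coercive\<close>). The sublevel set of \<open>f (y 0)\<close> thus lies in the ball of radius
\<open>f (y 0) / \<delta>\<close>, where the eigenvalues of \<open>X(y)\<close> are at least
\<open>\<mu> = exp (- \<surd>2 f (y 0) / \<delta>) / n\<close> (\<open>gibbs_ge\<close>). The linear rate (\<open>gradient_descent_linear_rate\<close>) gives
\<open>\<parallel>\<nabla>f (y k)\<parallel>\<^sup>2 \<le> (1 - 2 \<mu>) ^ k * f (y 0) \<le> exp (- 2 \<mu> k) * f (y 0)\<close>, and the bound on \<open>k\<close> is what makes
the right side at most \<open>\<epsilon>\<^sup>2\<close>.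
\<close>

section \<open>Diagonalization of real symmetric matrices\<close>

lemma symmetric_mat_inner:
  assumes "symmetric_mat X"
  shows "(X *v x) \<bullet> y = x \<bullet> (X *v y)"
  using assms unfolding symmetric_mat_def
  by (metis dot_lmul_matrix vector_transpose_matrix)

text \<open>
A maximizer \<open>u\<close> of the Rayleigh quotient on an invariant subspace is a critical point: moving
from \<open>u\<close> in the direction of the residual \<open>w = X u - l u\<close> changes the quotient to first order by
\<open>2 (w \<bullet> w)\<close>, so \<open>w\<close> must vanish.
\<close>

lemma maximizer_is_eigenvector:
  fixes X :: "real^'n^'n"
  assumes sym: "symmetric_mat X" and S: "subspace S"
    and inv: "\<And>x. x \<in> S \<Longrightarrow> X *v x \<in> S"
    and u: "u \<in> S" "norm u = 1"
    and max: "\<And>x. x \<in> S \<Longrightarrow> norm x = 1 \<Longrightarrow> x \<bullet> (X *v x) \<le> u \<bullet> (X *v u)"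
  shows "X *v u = (u \<bullet> (X *v u)) *\<^sub>R u"
proof -
  define l where "l = u \<bullet> (X *v u)"
  define w where "w = X *v u - l *\<^sub>R u"
  have uu: "u \<bullet> u = 1" using u by (simp add: dot_square_norm)
  have wS: "w \<in> S"
    unfolding w_def using S inv u by (simp add: subspace_diff subspace_scale)
  have wu: "w \<bullet> u = 0"
    unfolding w_def l_def by (simp add: inner_diff_left uu inner_commute[of "X *v u" u])
  have ww: "w \<bullet> (X *v u) = w \<bullet> w"
    using wu unfolding w_def by (simp add: inner_diff_right inner_diff_left)
  have homogeneous: "x \<bullet> (X *v x) \<le> l * (x \<bullet> x)" if "x \<in> S" for x
  proof (cases "x = 0")
    case False
    have "(x /\<^sub>R norm x) \<bullet> (X *v (x /\<^sub>R norm x)) \<le> l"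
      unfolding l_def using that S False by (intro max) (auto simp: subspace_scale)
    then have "(x \<bullet> (X *v x)) / (norm x)\<^sup>2 \<le> l"
      by (simp add: matrix_vector_mult_scaleR power2_eq_square divide_simps)
    then show ?thesis using False by (simp add: dot_square_norm divide_simps)
  qed simp
  \<comment> \<open>maximality at \<open>u + t w\<close> bounds a term linear in \<open>t\<close> by a quadratic one\<close>
  define c where "c = l * (w \<bullet> w) - w \<bullet> (X *v w)"
  have quad: "2 * t * (w \<bullet> w) \<le> t\<^sup>2 * c" for t
  proof -
    have "u + t *\<^sub>R w \<in> S" using S u wS by (simp add: subspace_add subspace_scale)
    from homogeneous[OF this]
    have "l + t * (u \<bullet> (X *v w)) + t * (w \<bullet> (X *v u)) + t\<^sup>2 * (w \<bullet> (X *v w))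
        \<le> l * (1 + t\<^sup>2 * (w \<bullet> w))"
      using uu wu
      by (simp add: matrix_vector_right_distrib matrix_vector_mult_scaleR inner_add_left
          inner_add_right inner_commute[of u w] power2_eq_square l_def algebra_simps)
    moreover have "u \<bullet> (X *v w) = w \<bullet> w"
      using symmetric_mat_inner[OF sym, of u w] ww by (simp add: inner_commute)
    ultimately show ?thesis using ww by (simp add: c_def algebra_simps)
  qed
  have "w \<bullet> w = 0"
  proof (rule ccontr)
    assume "w \<bullet> w \<noteq> 0"
    then have pos: "w \<bullet> w > 0" by simp
    define t where "t = (w \<bullet> w) / (\<bar>c\<bar> + 1)"
    have tpos: "t > 0" using pos by (simp add: t_def)
    from quad[of t] have "t * (2 * (w \<bullet> w)) \<le> t * (t * c)" by (simp add: power2_eq_square ac_simps)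
    then have "2 * (w \<bullet> w) \<le> t * c" using tpos by (simp only: mult_le_cancel_left_pos)
    also have "\<dots> \<le> t * (\<bar>c\<bar> + 1)" using tpos by (intro mult_left_mono) auto
    also have "\<dots> = w \<bullet> w" by (simp add: t_def)
    finally show False using pos by simp
  qed
  then show ?thesis unfolding w_def l_def by simp
qed

definition orthonormal_frame :: "('n \<Rightarrow> real^'n) \<Rightarrow> bool" where
  "orthonormal_frame u \<longleftrightarrow> (\<forall>i j. u i \<bullet> u j = (if i = j then 1 else 0))"

text \<open>
The matrix with rows \<open>u i\<close> has a right inverse, its transpose, which is then also a left inverse;
this is the completeness relation that turns sums over a frame into inner products.
\<close>

lemma frame_completeness:
  fixes u :: "'n::finite \<Rightarrow> real^'n"
  assumes "orthonormal_frame u"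
  shows "(\<Sum>i\<in>UNIV. u i $ r * u i $ s) = (if r = s then 1 else 0)"
proof -
  define Q :: "real^'n^'n" where "Q = (\<chi> i. u i)"
  have "Q ** transpose Q = mat 1"
    using assms
    by (simp add: orthonormal_frame_def Q_def matrix_matrix_mult_def transpose_def mat_def
        inner_vec_def vec_eq_iff)
  then have "transpose Q ** Q = mat 1" by (simp add: matrix_left_right_inverse)
  then have "(transpose Q ** Q) $ r $ s = (mat 1 :: real^'n^'n) $ r $ s" by simp
  then show ?thesis by (simp add: Q_def matrix_matrix_mult_def transpose_def mat_def)
qed

lemma frame_parseval:
  fixes u :: "'n::finite \<Rightarrow> real^'n"
  assumes "orthonormal_frame u"
  shows "(\<Sum>i\<in>UNIV. (u i \<bullet> v) * (u i \<bullet> w)) = v \<bullet> w"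
proof -
  have "(\<Sum>i\<in>UNIV. (u i \<bullet> v) * (u i \<bullet> w))
      = (\<Sum>i\<in>UNIV. \<Sum>r\<in>UNIV. \<Sum>s\<in>UNIV. u i $ r * u i $ s * (v $ r * w $ s))"
    by (simp add: inner_vec_def sum_product ac_simps)
  also have "\<dots> = (\<Sum>r\<in>UNIV. \<Sum>s\<in>UNIV. (\<Sum>i\<in>UNIV. u i $ r * u i $ s) * (v $ r * w $ s))"
    by (subst sum.swap, rule sum.cong[OF refl], subst sum.swap) (simp add: sum_distrib_right)
  also have "\<dots> = v \<bullet> w"
    by (simp add: frame_completeness[OF assms] inner_vec_def if_distrib[of "\<lambda>x. x * _"] cong: if_cong)
  finally show ?thesis .
qed

lemma frame_norm:
  fixes u :: "'n::finite \<Rightarrow> real^'n"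
  assumes "orthonormal_frame u"
  shows "(\<Sum>i\<in>UNIV. (u i \<bullet> v)\<^sup>2) = (norm v)\<^sup>2"
  using frame_parseval[OF assms, of v v] by (simp add: power2_eq_square dot_square_norm)

definition frame_diag :: "('n \<Rightarrow> real^'n) \<Rightarrow> ('n \<Rightarrow> real) \<Rightarrow> real^'n^'n" where
  "frame_diag u l = (\<chi> r s. \<Sum>i\<in>UNIV. l i * (u i $ r * u i $ s))"

lemma frame_diag_mult_vector:
  fixes u :: "'n::finite \<Rightarrow> real^'n"
  shows "frame_diag u l *v w = (\<Sum>i\<in>UNIV. (l i * (u i \<bullet> w)) *\<^sub>R u i)"
proof -
  have "(frame_diag u l *v w) $ r = (\<Sum>i\<in>UNIV. (l i * (u i \<bullet> w)) *\<^sub>R u i) $ r" for r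
  proof -
    have "(frame_diag u l *v w) $ r = (\<Sum>s\<in>UNIV. \<Sum>i\<in>UNIV. l i * (u i $ r * u i $ s) * w $ s)"
      by (simp add: frame_diag_def matrix_vector_mult_def sum_distrib_right)
    also have "\<dots> = (\<Sum>i\<in>UNIV. l i * (\<Sum>s\<in>UNIV. u i $ s * w $ s) * u i $ r)"
      by (subst sum.swap) (simp add: sum_distrib_left sum_distrib_right ac_simps)
    finally show ?thesis by (simp add: inner_vec_def sum_component)
  qed
  then show ?thesis by (simp add: vec_eq_iff)
qed

lemma frame_diag_eigenvector:
  fixes u :: "'n::finite \<Rightarrow> real^'n"
  assumes "orthonormal_frame u"
  shows "frame_diag u l *v u k = l k *\<^sub>R u k"
proof -
  have "frame_diag u l *v u k = (\<Sum>i\<in>UNIV. if i = k then l i *\<^sub>R u i else 0)"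
    unfolding frame_diag_mult_vector using assms
    by (intro sum.cong refl) (simp add: orthonormal_frame_def)
  then show ?thesis by simp
qed

lemma matrix_eq_on_frame:
  fixes u :: "'n::finite \<Rightarrow> real^'n" and B C :: "real^'n^'n"
  assumes "orthonormal_frame u" and "\<And>i. B *v u i = C *v u i"
  shows "B = C"
proof -
  have "w = (\<Sum>i\<in>UNIV. (u i \<bullet> w) *\<^sub>R u i)" for w
  proof -
    have "(\<Sum>i\<in>UNIV. (u i \<bullet> w) *\<^sub>R u i) \<bullet> z = w \<bullet> z" for z
      using frame_parseval[OF assms(1), of w z] by (simp add: inner_sum_left)
    then show ?thesis by (metis vector_eq_rdot)
  qed
  note expansion = this
  have "B *v w = C *v w" for w
    by (subst (1 2) expansion)
      (simp add: assms(2) linear_sum[OF matrix_vector_mul_linear] matrix_vector_mult_scaleR)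
  then show ?thesis by (simp add: matrix_eq)
qed

text \<open>
Among all orthonormal sets of eigenvectors take one of largest size. Its orthogonal complement is
invariant, so if it were nonzero, a maximizer of the Rayleigh quotient on its unit sphere would be
a further eigenvector.
\<close>

theorem symmetric_mat_diagonalizable:
  fixes X :: "real^'n^'n"
  assumes sym: "symmetric_mat X"
  obtains u l where "orthonormal_frame u" "X = frame_diag u l"
proof -
  define P where "P B \<longleftrightarrow> pairwise orthogonal B \<and>
      (\<forall>v\<in>B. norm v = 1 \<and> (\<exists>l. X *v v = l *\<^sub>R v))" for B :: "(real^'n) set"
  have indep: "independent B" if "P B" for B
    using that unfolding P_def by (metis norm_zero pairwise_orthogonal_independent zero_neq_one)
  have bound: "card B \<le> CARD('n)" if "P B" for B
    using independent_bound[OF indep[OF that]] by simp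
  have "P {}" by (simp add: P_def)
  then obtain B where PB: "P B" and maxB: "\<And>C. P C \<Longrightarrow> card C \<le> card B"
    using bound ex_has_greatest_nat[of P "{}" card "CARD('n)"]
    by (metis order_le_imp_less_or_eq less_Suc_eq_le)
  define S where "S = {x. \<forall>v\<in>B. v \<bullet> x = 0}"
  have eigB: "\<exists>l. X *v v = l *\<^sub>R v" if "v \<in> B" for v
    using PB that by (simp add: P_def)
  have S: "subspace S" by (auto simp: S_def subspace_def inner_add_right)
  have inv: "X *v x \<in> S" if "x \<in> S" for x
  proof -
    have "v \<bullet> (X *v x) = 0" if v: "v \<in> B" for v
    proof -
      obtain l where "X *v v = l *\<^sub>R v" using eigB[OF v] ..
      then have "v \<bullet> (X *v x) = l * (v \<bullet> x)"
        using symmetric_mat_inner[OF sym, of v x] by simp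
      then show ?thesis using \<open>x \<in> S\<close> v by (simp add: S_def)
    qed
    then show ?thesis by (simp add: S_def)
  qed
  have spanB: "span B = UNIV"
  proof (rule ccontr)
    assume "span B \<noteq> UNIV"
    then have "dim (span B) < DIM(real^'n)"
      by (metis dim_span dim_eq_full dim_subset_UNIV le_neq_implies_less)
    then obtain x where x: "x \<noteq> 0" "\<And>v. v \<in> span B \<Longrightarrow> orthogonal x v"
      using orthogonal_to_subspace_exists[of B] by auto
    then have xS: "x \<in> S"
      by (auto simp: S_def orthogonal_def inner_commute span_base)
    define K where "K = S \<inter> sphere 0 1"
    have "compact K" unfolding K_def using closed_subspace[OF S] by (simp add: closed_Int_compact)
    moreover have "x /\<^sub>R norm x \<in> K"
      using x xS S by (auto simp: K_def subspace_scale)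
    then have "K \<noteq> {}" by blast
    moreover have "continuous_on K (\<lambda>x. x \<bullet> (X *v x))"
      by (intro continuous_intros matrix_vector_mult_linear_continuous_on)
    ultimately obtain u where u: "u \<in> K" "\<And>x. x \<in> K \<Longrightarrow> x \<bullet> (X *v x) \<le> u \<bullet> (X *v u)"
      using continuous_attains_sup[of K] by metis
    have eig: "X *v u = (u \<bullet> (X *v u)) *\<^sub>R u"
      using u by (intro maximizer_is_eigenvector[OF sym S inv]) (auto simp: K_def)
    have "u \<notin> B" using u by (auto simp: K_def S_def)
    moreover have "P (insert u B)"
      using PB u eig unfolding P_def K_def S_def pairwise_insert
      by (auto simp: orthogonal_def inner_commute)
    moreover have "finite B" using indep[OF PB] by (rule independent_imp_finite)
    ultimately show False using maxB[of "insert u B"] by simp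
  qed
  have "finite B" using indep[OF PB] by (rule independent_imp_finite)
  moreover have "card B = CARD('n)"
    using dim_eq_card_independent[OF indep[OF PB]] spanB by (metis dim_span dim_UNIV DIM_cart DIM_real mult.right_neutral)
  ultimately obtain u :: "'n \<Rightarrow> real^'n" where u: "bij_betw u UNIV B"
    using finite_same_card_bij[of "UNIV :: 'n set" B] by auto
  have uB: "u i \<in> B" for i using u by (auto simp: bij_betw_def)
  have frame: "orthonormal_frame u"
    unfolding orthonormal_frame_def
  proof (intro allI)
    fix i j
    show "u i \<bullet> u j = (if i = j then 1 else 0)"
    proof (cases "i = j")
      case True
      then show ?thesis using PB uB by (simp add: P_def dot_square_norm)
    next
      case False
      then have "u i \<noteq> u j" using u by (auto simp: bij_betw_def inj_on_def)
      then show ?thesis using PB uB False by (auto simp: P_def pairwise_def orthogonal_def)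
    qed
  qed
  obtain l where l: "\<And>i. X *v u i = l i *\<^sub>R u i"
    using eigB[OF uB] by metis
  have "X = frame_diag u l"
    by (rule matrix_eq_on_frame[OF frame]) (simp add: l frame_diag_eigenvector[OF frame])
  then show ?thesis using that frame by blast
qed

section \<open>Exponentials and Gibbs states in an eigenframe\<close>

lemma trace_mult_frame_diag:
  fixes u :: "'n::finite \<Rightarrow> real^'n" and B :: "real^'n^'n"
  shows "trace (B ** frame_diag u l) = (\<Sum>i\<in>UNIV. l i * (u i \<bullet> (B *v u i)))"
proof -
  have "trace (B ** frame_diag u l)
      = (\<Sum>r\<in>UNIV. \<Sum>s\<in>UNIV. \<Sum>i\<in>UNIV. l i * (u i $ r * (B $ r $ s * u i $ s)))"
    by (simp add: trace_def matrix_matrix_mult_def frame_diag_def sum_distrib_left ac_simps)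
  also have "\<dots> = (\<Sum>r\<in>UNIV. \<Sum>i\<in>UNIV. \<Sum>s\<in>UNIV. l i * (u i $ r * (B $ r $ s * u i $ s)))"
    by (intro sum.cong refl sum.swap)
  also have "\<dots> = (\<Sum>i\<in>UNIV. \<Sum>r\<in>UNIV. \<Sum>s\<in>UNIV. l i * (u i $ r * (B $ r $ s * u i $ s)))"
    by (rule sum.swap)
  finally show ?thesis
    by (simp add: inner_vec_def matrix_vector_mult_def sum_distrib_left)
qed

lemma frame_diag_one:
  fixes u :: "'n::finite \<Rightarrow> real^'n"
  assumes "orthonormal_frame u"
  shows "frame_diag u (\<lambda>_. 1) = mat 1"
  by (rule matrix_eq_on_frame[OF assms]) (simp add: frame_diag_eigenvector[OF assms])

lemma trace_eq_frame_sum: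
  fixes u :: "'n::finite \<Rightarrow> real^'n" and B :: "real^'n^'n"
  assumes "orthonormal_frame u"
  shows "trace B = (\<Sum>i\<in>UNIV. u i \<bullet> (B *v u i))"
  using trace_mult_frame_diag[of B u "\<lambda>_. 1"] by (simp add: frame_diag_one[OF assms])

lemma frame_unit:
  assumes "orthonormal_frame u"
  shows "norm (u i) = 1" "u i \<bullet> u i = 1"
  using assms by (simp_all add: orthonormal_frame_def norm_eq_sqrt_inner)

lemma trace_frame_diag:
  fixes u :: "'n::finite \<Rightarrow> real^'n"
  assumes "orthonormal_frame u"
  shows "trace (frame_diag u l) = (\<Sum>i\<in>UNIV. l i)"
  by (simp add: trace_eq_frame_sum[OF assms] frame_diag_eigenvector[OF assms] frame_unit[OF assms])

lemma frame_diag_mult: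
  fixes u :: "'n::finite \<Rightarrow> real^'n"
  assumes "orthonormal_frame u"
  shows "frame_diag u l ** frame_diag u m = frame_diag u (\<lambda>i. l i * m i)"
  by (rule matrix_eq_on_frame[OF assms])
    (simp add: frame_diag_eigenvector[OF assms] matrix_vector_mult_scaleR mult.commute
      flip: matrix_vector_mul_assoc)

lemma frame_diag_scaleR: "c *\<^sub>R frame_diag u l = frame_diag u (\<lambda>i. c * l i)"
  by (simp add: frame_diag_def vec_eq_iff sum_distrib_left mult.assoc)

lemma mat_power_frame_diag:
  fixes u :: "'n::finite \<Rightarrow> real^'n"
  assumes "orthonormal_frame u"
  shows "mat_power (frame_diag u l) k = frame_diag u (\<lambda>i. l i ^ k)"
  by (induction k) (simp_all add: frame_diag_one[OF assms] frame_diag_mult[OF assms])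

lemma mat_exp_frame_diag:
  fixes u :: "'n::finite \<Rightarrow> real^'n"
  assumes "orthonormal_frame u"
  shows "mat_exp (frame_diag u l) = frame_diag u (\<lambda>i. exp (l i))"
proof -
  define E :: "'n \<Rightarrow> real^'n^'n" where "E i = (\<chi> r s. u i $ r * u i $ s)" for i
  have as_sum: "frame_diag u m = (\<Sum>i\<in>UNIV. m i *\<^sub>R E i)" for m
    by (simp add: frame_diag_def E_def vec_eq_iff)
  have "(\<lambda>k. l i ^ k /\<^sub>R fact k) sums exp (l i)" for i
    by (rule exp_converges)
  then have "(\<lambda>k. \<Sum>i\<in>UNIV. (l i ^ k /\<^sub>R fact k) *\<^sub>R E i) sums (\<Sum>i\<in>UNIV. exp (l i) *\<^sub>R E i)"
    by (intro sums_sum sums_scaleR_left)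
  then have "(\<lambda>k. \<Sum>i\<in>UNIV. (l i ^ k /\<^sub>R fact k) *\<^sub>R E i) sums frame_diag u (\<lambda>i. exp (l i))"
    by (simp only: as_sum)
  moreover have "(\<Sum>i\<in>UNIV. (l i ^ k /\<^sub>R fact k) *\<^sub>R E i)
      = (1 / fact k) *\<^sub>R mat_power (frame_diag u l) k" for k
    unfolding mat_power_frame_diag[OF assms] frame_diag_scaleR
    by (simp add: as_sum divide_inverse mult.commute)
  ultimately have "(\<lambda>k. (1 / fact k) *\<^sub>R mat_power (frame_diag u l) k) sums frame_diag u (\<lambda>i. exp (l i))"
    by (simp only:)
  then show ?thesis
    unfolding mat_exp_def by (rule sums_unique[symmetric])
qed

definition log_partition :: "real^'n^'n \<Rightarrow> real" where
  "log_partition X = ln (trace (mat_exp X))"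

text \<open>
The state \<open>exp X / tr exp X\<close> of which the gradient of the potential takes moments; for symmetric
\<open>X\<close> it lies in the spectraplex.
\<close>

definition gibbs :: "real^'n^'n \<Rightarrow> real^'n^'n" where
  "gibbs X = (1 / trace (mat_exp X)) *\<^sub>R mat_exp X"

lemma exp_log_partition:
  fixes u :: "'n::finite \<Rightarrow> real^'n"
  assumes "orthonormal_frame u"
  shows "exp (log_partition (frame_diag u l)) = (\<Sum>i\<in>UNIV. exp (l i))"
proof -
  have "(\<Sum>i\<in>UNIV. exp (l i)) > 0" by (intro sum_pos) auto
  then show ?thesis
    by (simp add: log_partition_def mat_exp_frame_diag[OF assms] trace_frame_diag[OF assms])
qed

lemma gibbs_frame_diag:
  fixes u :: "'n::finite \<Rightarrow> real^'n"
  assumes "orthonormal_frame u"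
  shows "gibbs (frame_diag u l)
    = frame_diag u (\<lambda>i. exp (l i - log_partition (frame_diag u l)))"
  by (simp add: gibbs_def exp_diff exp_log_partition[OF assms] mat_exp_frame_diag[OF assms]
      trace_frame_diag[OF assms] frame_diag_scaleR)

lemma sum_gibbs_weights:
  fixes u :: "'n::finite \<Rightarrow> real^'n"
  assumes "orthonormal_frame u"
  shows "(\<Sum>i\<in>UNIV. exp (l i - log_partition (frame_diag u l))) = 1"
proof -
  have "(\<Sum>i\<in>UNIV. exp (l i)) > 0" by (intro sum_pos) auto
  then show ?thesis
    by (simp add: exp_diff exp_log_partition[OF assms] flip: sum_divide_distrib)
qed

lemma trace_gibbs:
  assumes "symmetric_mat X"
  shows "trace (gibbs X) = 1"
proof -
  obtain u l where u: "orthonormal_frame u" and X: "X = frame_diag u l"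
    using symmetric_mat_diagonalizable[OF assms] .
  then show ?thesis
    by (simp add: gibbs_frame_diag[OF u] trace_frame_diag[OF u] sum_gibbs_weights[OF u])
qed

lemma trace_frame_diag_mult:
  fixes u v :: "'n::finite \<Rightarrow> real^'n"
  shows "trace (frame_diag v m ** frame_diag u l)
    = (\<Sum>i\<in>UNIV. \<Sum>j\<in>UNIV. (u i \<bullet> v j)\<^sup>2 * (l i * m j))"
  by (simp add: trace_mult_frame_diag frame_diag_mult_vector inner_sum_right sum_distrib_left
      power2_eq_square inner_commute ac_simps)

text \<open>
The squared overlaps \<open>(u i \<bullet> v j)\<^sup>2\<close> of two frames form a doubly stochastic matrix. They act as a
coupling of the two spectra, through which traces of products of noncommuting matrices become
double sums over pairs of eigenvalues.
\<close>

lemma frame_overlap_sums: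
  fixes u v :: "'n::finite \<Rightarrow> real^'n"
  assumes "orthonormal_frame u" "orthonormal_frame v"
  shows "(\<Sum>i\<in>UNIV. \<Sum>j\<in>UNIV. (u i \<bullet> v j)\<^sup>2 * g i) = (\<Sum>i\<in>UNIV. g i)"
    and "(\<Sum>i\<in>UNIV. \<Sum>j\<in>UNIV. (u i \<bullet> v j)\<^sup>2 * h j) = (\<Sum>j\<in>UNIV. h j)"
proof -
  have "(\<Sum>j\<in>UNIV. (u i \<bullet> v j)\<^sup>2) = 1" for i
    using frame_norm[OF assms(2), of "u i"] by (simp add: frame_unit[OF assms(1)] inner_commute)
  then show "(\<Sum>i\<in>UNIV. \<Sum>j\<in>UNIV. (u i \<bullet> v j)\<^sup>2 * g i) = (\<Sum>i\<in>UNIV. g i)"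
    by (simp flip: sum_distrib_right)
  have "(\<Sum>i\<in>UNIV. (u i \<bullet> v j)\<^sup>2) = 1" for j
    using frame_norm[OF assms(1), of "v j"] by (simp add: frame_unit[OF assms(2)])
  then show "(\<Sum>i\<in>UNIV. \<Sum>j\<in>UNIV. (u i \<bullet> v j)\<^sup>2 * h j) = (\<Sum>j\<in>UNIV. h j)"
    by (subst sum.swap) (simp flip: sum_distrib_right)
qed

section \<open>The tangent gap of the log-partition function\<close>

text \<open>
The amount by which \<open>log tr exp\<close> at \<open>Q\<close> exceeds its linear approximation at \<open>P\<close>, if \<open>gibbs P\<close> is
its gradient at \<open>P\<close>. It equals the quantum relative entropy of \<open>gibbs P\<close> with respect to
\<open>gibbs Q\<close>. That \<open>gibbs P\<close> is the gradient is deduced from the bounds on this quantity.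
\<close>

definition bregman :: "real^'n^'n \<Rightarrow> real^'n^'n \<Rightarrow> real" where
  "bregman P Q = log_partition Q - log_partition P - trace ((Q - P) ** gibbs P)"

lemma matrix_diff_rdistrib: "(A - B) ** C = A ** C - B ** (C :: real^'n^'n)"
  by (simp add: matrix_matrix_mult_def vec_eq_iff left_diff_distrib sum_subtractf)

text \<open>
In the coupled spectra the gap is an average of scalar tangent gaps of the exponential function,
evaluated at the logarithms \<open>\<alpha> i\<close> and \<open>\<beta> j\<close> of the eigenvalues of the two Gibbs states. The terms
\<open>exp (\<beta> j)\<close> and \<open>exp (\<alpha> i)\<close> contribute \<open>1 - 1 = 0\<close> in total; they make every summand nonnegative.
\<close>

lemma bregman_double_sum:
  fixes u v :: "'n::finite \<Rightarrow> real^'n" and a b :: "'n \<Rightarrow> real"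
  assumes u: "orthonormal_frame u" and v: "orthonormal_frame v"
    and P: "P = frame_diag u a" and Q: "Q = frame_diag v b"
  defines "\<alpha> \<equiv> \<lambda>i. a i - log_partition P" and "\<beta> \<equiv> \<lambda>j. b j - log_partition Q"
  shows "bregman P Q = (\<Sum>i\<in>UNIV. \<Sum>j\<in>UNIV. (u i \<bullet> v j)\<^sup>2
      * (exp (\<beta> j) - exp (\<alpha> i) - exp (\<alpha> i) * (\<beta> j - \<alpha> i)))"
proof -
  define p where "p = (\<lambda>i. exp (\<alpha> i))"
  have gP: "gibbs P = frame_diag u p"
    by (simp add: P gibbs_frame_diag[OF u] p_def \<alpha>_def)
  have sum1: "(\<Sum>i\<in>UNIV. p i) = 1"
    unfolding p_def \<alpha>_def P by (rule sum_gibbs_weights[OF u])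
  have sum2: "(\<Sum>i\<in>UNIV. exp (\<beta> i)) = 1"
    unfolding \<beta>_def Q by (rule sum_gibbs_weights[OF v])
  have "trace (Q ** gibbs P) = (\<Sum>i\<in>UNIV. \<Sum>j\<in>UNIV. (u i \<bullet> v j)\<^sup>2 * (p i * b j))"
    by (simp add: gP Q trace_frame_diag_mult)
  moreover have "trace (P ** gibbs P) = (\<Sum>i\<in>UNIV. \<Sum>j\<in>UNIV. (u i \<bullet> v j)\<^sup>2 * (p i * a i))"
    unfolding gP frame_overlap_sums(1)[OF u v]
    by (simp add: P frame_diag_mult[OF u] trace_frame_diag[OF u] mult.commute)
  moreover have "(\<Sum>i\<in>UNIV. \<Sum>j\<in>UNIV. (u i \<bullet> v j)\<^sup>2 * exp (\<beta> j)) = 1"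
    "(\<Sum>i\<in>UNIV. \<Sum>j\<in>UNIV. (u i \<bullet> v j)\<^sup>2 * p i) = 1"
    by (simp_all add: frame_overlap_sums[OF u v] sum1 sum2)
  moreover have "(\<Sum>i\<in>UNIV. \<Sum>j\<in>UNIV. (u i \<bullet> v j)\<^sup>2 * (p i * c)) = c" for c
    using frame_overlap_sums(1)[OF u v, of "\<lambda>i. p i * c"] sum1 by (simp flip: sum_distrib_right)
  moreover have "(\<Sum>i\<in>UNIV. \<Sum>j\<in>UNIV. (u i \<bullet> v j)\<^sup>2
      * (exp (\<beta> j) - exp (\<alpha> i) - exp (\<alpha> i) * (\<beta> j - \<alpha> i)))
    = (\<Sum>i\<in>UNIV. \<Sum>j\<in>UNIV. (u i \<bullet> v j)\<^sup>2 * exp (\<beta> j)) - (\<Sum>i\<in>UNIV. \<Sum>j\<in>UNIV. (u i \<bullet> v j)\<^sup>2 * p i)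
      - (\<Sum>i\<in>UNIV. \<Sum>j\<in>UNIV. (u i \<bullet> v j)\<^sup>2 * (p i * b j))
      + (\<Sum>i\<in>UNIV. \<Sum>j\<in>UNIV. (u i \<bullet> v j)\<^sup>2 * (p i * log_partition Q))
      + (\<Sum>i\<in>UNIV. \<Sum>j\<in>UNIV. (u i \<bullet> v j)\<^sup>2 * (p i * a i))
      - (\<Sum>i\<in>UNIV. \<Sum>j\<in>UNIV. (u i \<bullet> v j)\<^sup>2 * (p i * log_partition P))"
    unfolding sum_subtractf[symmetric] sum.distrib[symmetric]
    by (intro sum.cong refl) (simp add: p_def \<alpha>_def \<beta>_def algebra_simps)
  ultimately show ?thesis
    by (simp add: bregman_def matrix_diff_rdistrib trace_sub)
qed

lemma exp_strongly_convex:
  fixes \<mu> s t :: real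
  assumes "0 < \<mu>" "\<mu> \<le> exp s" "\<mu> \<le> exp t"
  shows "\<mu> / 2 * (s - t)\<^sup>2 \<le> exp t - exp s - exp s * (t - s)"
proof -
  define m where "m = ln \<mu>"
  have mu: "\<mu> = exp m" using assms by (simp add: m_def)
  have st: "m \<le> s" "m \<le> t" using assms(2,3) by (simp_all add: mu)
  define \<phi> where "\<phi> x = exp x - \<mu> / 2 * x\<^sup>2" for x :: real
  have "(exp s - \<mu> * s) * (t - s) \<le> \<phi> t - \<phi> s"
  proof (rule f''_imp_f'[where C = "{m..}"])
    show "(\<phi> has_real_derivative exp x - \<mu> * x) (at x)" for x
      unfolding \<phi>_def by (auto intro!: derivative_eq_intros)
    show "((\<lambda>x. exp x - \<mu> * x) has_real_derivative exp x - \<mu>) (at x)" for x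
      by (auto intro!: derivative_eq_intros)
  qed (use st in \<open>simp_all add: mu\<close>)
  then show ?thesis by (simp add: \<phi>_def power2_eq_square algebra_simps)
qed

text \<open>
The scalar inequality behind the sharp constant in Pinsker's inequality. The difference of the two
sides vanishes to first order at \<open>1\<close>, and its second derivative \<open>1 / x - 27 / (x + 2)\<^sup>3\<close> is
nonnegative by the arithmetic-geometric mean inequality for \<open>x, 1, 1\<close>.
\<close>

lemma mult_ln_lower_bound:
  fixes x :: real
  assumes "x > 0"
  shows "3 * (x - 1)\<^sup>2 / (2 * (x + 2)) \<le> x * ln x - x + 1"
proof -
  \<comment> \<open>the difference of the two sides, with the rational part split into partial fractions so
    that its second derivative is a difference of two simple terms\<close>
  define F where "F x = x * ln x - x + 1 - (3/2) * x + 6 - 27 / (2 * (x + 2))" for x :: real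
  have F: "F x = x * ln x - x + 1 - 3 * (x - 1)\<^sup>2 / (2 * (x + 2))" if "x > 0" for x
    using that by (simp add: F_def power2_eq_square field_simps)
  have "(ln 1 - 3/2 + 27 / (2 * (1 + 2)\<^sup>2)) * (x - 1) \<le> F x - F 1"
  proof (rule f''_imp_f'[where C = "{0<..}"])
    show "(F has_real_derivative ln x - 3/2 + 27 / (2 * (x + 2)\<^sup>2)) (at x)" if "x \<in> {0<..}" for x :: real
    proof -
      have "x + 2 \<noteq> 0" using that by auto
      have "(F has_real_derivative 1 * ln x + x * (1 / x) - 1 + 0 - 3/2 + 0
          - (0 * (2 * (x + 2)) - 27 * (2 * (1 + 0))) / ((2 * (x + 2)) * (2 * (x + 2)))) (at x)"
        unfolding F_def using that \<open>x + 2 \<noteq> 0\<close>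
        by (auto intro!: derivative_eq_intros)
      moreover have "27 * 2 / ((2 * z) * (2 * z)) = 27 / (2 * z\<^sup>2)" for z :: real
        by (simp add: power2_eq_square)
      from this[of "x + 2"] have "0 - (0 * (2 * (x + 2)) - 27 * (2 * (1 + 0))) / ((2 * (x + 2)) * (2 * (x + 2)))
          = 27 / (2 * (x + 2)\<^sup>2)" by (simp only: diff_0 mult_zero_left add_0_right mult_1_right minus_divide_left minus_minus)
      ultimately show ?thesis using that by simp
    qed
    show "((\<lambda>x. ln x - 3/2 + 27 / (2 * (x + 2)\<^sup>2)) has_real_derivative 1 / x - 27 / (x + 2) ^ 3) (at x)"
      if "x \<in> {0<..}" for x :: real
    proof -
      have "x + 2 \<noteq> 0" using that by auto
      have cube: "4 * 27 * z / (2 * z\<^sup>2)\<^sup>2 = 27 / z ^ 3" for z :: real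
        by (simp add: power2_eq_square power3_eq_cube)
      have "((\<lambda>x. ln x - 3/2 + 27 / (2 * (x + 2)\<^sup>2)) has_real_derivative
          1 / x - 4 * 27 * (x + 2) / (2 * (x + 2)\<^sup>2)\<^sup>2) (at x)"
        using that \<open>x + 2 \<noteq> 0\<close>
        by (auto intro!: derivative_eq_intros simp: power2_eq_square[of "2 * _"])
          (simp add: minus_divide_left)
      then show ?thesis by (simp only: cube)
    qed
    show "0 \<le> 1 / x - 27 / (x + 2) ^ 3" if "x \<in> {0<..}" for x :: real
    proof -
      \<comment> \<open>this product is exactly \<open>(x + 2)\<^sup>3 - 27 x\<close>\<close>
      have "0 \<le> (x - 1)\<^sup>2 * (x + 8)" using that by simp
      then have "27 * x \<le> (x + 2) ^ 3"
        by (simp add: power2_eq_square power3_eq_cube algebra_simps)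
      then show ?thesis using that by (simp add: divide_simps)
    qed
  qed (use assms in auto)
  then show ?thesis using F[OF assms] F[of 1] by simp
qed

text \<open>
The previous inequality at \<open>x = exp (t - s)\<close>, multiplied by \<open>exp s\<close>.
\<close>

lemma exp_tangent_gap_ge:
  fixes s t :: real
  shows "3 * (exp t - exp s)\<^sup>2 / (2 * (exp t + 2 * exp s)) \<le> exp s - exp t - exp t * (s - t)"
proof -
  have pos: "exp t + exp s * 2 > 0" by (simp add: add_pos_pos)
  have "3 * (exp (t - s) - 1)\<^sup>2 / (2 * (exp (t - s) + 2))
      \<le> exp (t - s) * (t - s) - exp (t - s) + 1"
    using mult_ln_lower_bound[of "exp (t - s)"] by simp
  then have "exp s * (3 * (exp (t - s) - 1)\<^sup>2 / (2 * (exp (t - s) + 2)))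
      \<le> exp s * (exp (t - s) * (t - s) - exp (t - s) + 1)"
    by (rule mult_left_mono) simp
  moreover have "exp s * (3 * (exp (t - s) - 1)\<^sup>2 / (2 * (exp (t - s) + 2)))
      = 3 * (exp t - exp s)\<^sup>2 / (2 * (exp t + 2 * exp s))"
    using pos by (simp add: exp_diff divide_simps power2_eq_square)
  moreover have "exp s * (exp (t - s) * (t - s) - exp (t - s) + 1)
      = exp s - exp t - exp t * (s - t)"
  proof -
    have "exp t = exp s * exp (t - s)" by (simp flip: exp_add)
    then show ?thesis by (simp add: algebra_simps)
  qed
  ultimately show ?thesis by simp
qed

lemma gibbs_eigenvalue_ge:
  fixes u :: "'n::finite \<Rightarrow> real^'n"
  assumes u: "orthonormal_frame u" and P: "P = frame_diag u a"
    and ge: "\<And>x. \<mu> * (norm x)\<^sup>2 \<le> x \<bullet> (gibbs P *v x)"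
  shows "\<mu> \<le> exp (a i - log_partition P)"
  using ge[of "u i"]
  by (simp add: P gibbs_frame_diag[OF u] frame_diag_eigenvector[OF u] frame_unit[OF u])

lemma matrix_diff_ldistrib: "C ** (A - B) = C ** A - C ** (B :: real^'n^'n)"
  by (simp add: matrix_matrix_mult_def vec_eq_iff right_diff_distrib sum_subtractf)

text \<open>
Strong convexity. On \<open>{ln \<mu>..}\<close> the exponential function is \<open>\<mu>\<close>-strongly convex, so each summand of
the double sum is at least \<open>\<mu> / 2\<close> times the squared difference of the logarithmic eigenvalues.
These differ from the eigenvalues of \<open>P\<close> and \<open>Q\<close> by the normalizing constants only, and since
\<open>Q - P\<close> is traceless, the normalization can only increase the sum of squares.
\<close>

lemma bregman_ge_norm:
  fixes P Q :: "real^'n^'n"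
  assumes P: "symmetric_mat P" and Q: "symmetric_mat Q" and tr: "trace P = trace Q"
    and mu: "0 < \<mu>"
    and geP: "\<And>x. \<mu> * (norm x)\<^sup>2 \<le> x \<bullet> (gibbs P *v x)"
    and geQ: "\<And>x. \<mu> * (norm x)\<^sup>2 \<le> x \<bullet> (gibbs Q *v x)"
  shows "\<mu> / 2 * trace ((Q - P) ** (Q - P)) \<le> bregman P Q"
proof -
  obtain u a where u: "orthonormal_frame u" and Pa: "P = frame_diag u a"
    using symmetric_mat_diagonalizable[OF P] .
  obtain v b where v: "orthonormal_frame v" and Qb: "Q = frame_diag v b"
    using symmetric_mat_diagonalizable[OF Q] .
  define \<kappa> where "\<kappa> = log_partition P - log_partition Q"
  let ?c = "\<lambda>i j. (u i \<bullet> v j)\<^sup>2"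
  have "trace ((Q - P) ** (Q - P)) = trace (Q ** Q) - 2 * trace (Q ** P) + trace (P ** P)"
    by (simp add: matrix_diff_rdistrib matrix_diff_ldistrib trace_sub trace_mul_sym[of P Q])
  also have "\<dots> = (\<Sum>i\<in>UNIV. \<Sum>j\<in>UNIV. ?c i j * (b j)\<^sup>2)
      - 2 * (\<Sum>i\<in>UNIV. \<Sum>j\<in>UNIV. ?c i j * (a i * b j)) + (\<Sum>i\<in>UNIV. \<Sum>j\<in>UNIV. ?c i j * (a i)\<^sup>2)"
    unfolding frame_overlap_sums[OF u v] trace_frame_diag_mult[symmetric]
    by (simp add: Pa Qb frame_diag_mult[OF u] frame_diag_mult[OF v] trace_frame_diag[OF u]
        trace_frame_diag[OF v] power2_eq_square)
  also have "\<dots> = (\<Sum>i\<in>UNIV. \<Sum>j\<in>UNIV. ?c i j * (a i - b j)\<^sup>2)"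
    unfolding sum_distrib_left sum_subtractf[symmetric] sum.distrib[symmetric]
    by (intro sum.cong refl) (simp add: power2_eq_square algebra_simps)
  finally have tr_sq: "trace ((Q - P) ** (Q - P)) = (\<Sum>i\<in>UNIV. \<Sum>j\<in>UNIV. ?c i j * (a i - b j)\<^sup>2)" .
  have "(\<Sum>i\<in>UNIV. \<Sum>j\<in>UNIV. ?c i j * (a i - b j)) =
      (\<Sum>i\<in>UNIV. \<Sum>j\<in>UNIV. ?c i j * a i) - (\<Sum>i\<in>UNIV. \<Sum>j\<in>UNIV. ?c i j * b j)"
    by (simp add: right_diff_distrib sum_subtractf)
  also have "\<dots> = 0"
    unfolding frame_overlap_sums[OF u v]
    using tr by (simp add: Pa Qb trace_frame_diag[OF u] trace_frame_diag[OF v])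
  finally have mean: "(\<Sum>i\<in>UNIV. \<Sum>j\<in>UNIV. ?c i j * (a i - b j)) = 0" .
  have "(\<Sum>i\<in>UNIV. \<Sum>j\<in>UNIV. ?c i j * (a i - b j)\<^sup>2)
      \<le> (\<Sum>i\<in>UNIV. \<Sum>j\<in>UNIV. ?c i j * (a i - b j)\<^sup>2 + ?c i j * \<kappa>\<^sup>2)
        - 2 * \<kappa> * (\<Sum>i\<in>UNIV. \<Sum>j\<in>UNIV. ?c i j * (a i - b j))"
    unfolding mean by (simp add: sum_mono)
  also have "\<dots> = (\<Sum>i\<in>UNIV. \<Sum>j\<in>UNIV. ?c i j * (a i - b j - \<kappa>)\<^sup>2)"
    unfolding sum_distrib_left sum_subtractf[symmetric]
    by (intro sum.cong refl) (simp add: power2_eq_square algebra_simps)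
  finally have "\<mu> / 2 * trace ((Q - P) ** (Q - P))
      \<le> \<mu> / 2 * (\<Sum>i\<in>UNIV. \<Sum>j\<in>UNIV. ?c i j * (a i - b j - \<kappa>)\<^sup>2)"
    unfolding tr_sq using mu by (intro mult_left_mono) auto
  also have "\<dots> = (\<Sum>i\<in>UNIV. \<Sum>j\<in>UNIV. ?c i j *
      (\<mu> / 2 * ((a i - log_partition P) - (b j - log_partition Q))\<^sup>2))"
    unfolding sum_distrib_left by (intro sum.cong refl) (simp add: \<kappa>_def algebra_simps)
  also have "\<dots> \<le> bregman P Q"
    unfolding bregman_double_sum[OF u v Pa Qb]
    by (intro sum_mono mult_left_mono exp_strongly_convex mu gibbs_eigenvalue_ge[OF u Pa geP]
        gibbs_eigenvalue_ge[OF v Qb geQ]) simp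
  finally show ?thesis .
qed

text \<open>
Both gaps together form the monotonicity product of the gradients. An upper bound for one gap thus
follows from a lower bound for the other one.
\<close>

lemma bregman_symmetrized:
  "bregman P Q + bregman Q P = trace ((Q - P) ** gibbs Q) - trace ((Q - P) ** gibbs P)"
  by (simp add: bregman_def matrix_diff_rdistrib trace_sub)

text \<open>
The Young inequality that pairs a linear term with the lower bound for the tangent gap.
\<close>

lemma weighted_young:
  fixes x y w :: real
  assumes "w > 0"
  shows "x * y - 3 * x\<^sup>2 / (2 * w) \<le> y\<^sup>2 * w / 6"
proof -
  have "0 \<le> (3 * x - y * w)\<^sup>2 / (6 * w)" using assms by simp
  also have "\<dots> = 3 * x\<^sup>2 / (2 * w) - x * y + y\<^sup>2 * w / 6"
    using assms by (simp add: power2_eq_square field_simps)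
  finally show ?thesis by simp
qed

lemma trace_shift_mult:
  fixes K X :: "real^'n^'n"
  shows "trace ((K - c *\<^sub>R mat 1) ** X) = trace (K ** X) - c * trace X"
  by (simp add: matrix_diff_rdistrib trace_sub trace_def sum_subtractf sum_distrib_left
      flip: scalar_matrix_assoc)

lemma symmetric_mat_diff:
  "symmetric_mat X \<Longrightarrow> symmetric_mat Y \<Longrightarrow> symmetric_mat (X - Y)"
  by (simp add: symmetric_mat_def transpose_def vec_eq_iff)

lemma symmetric_mat_shift:
  "symmetric_mat X \<Longrightarrow> symmetric_mat (X - c *\<^sub>R mat 1)"
  by (simp add: symmetric_mat_def transpose_def vec_eq_iff mat_def)

text \<open>
Smoothness. In the double sum, the symmetrized gap has the summands \<open>s k (q - p)\<close>, where
\<open>s = u i \<bullet> v j\<close> is an overlap and \<open>k\<close> the corresponding entry of the shifted increment \<open>K\<close>. The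
opposite gap \<open>bregman Q P\<close>, which is subtracted from it, has summands of at least
\<open>3 s\<^sup>2 (q - p)\<^sup>2 / (2 (q + 2 p))\<close>. By Young's inequality what remains of each pair is at most
\<open>k\<^sup>2 (q + 2 p) / 6\<close>, and these terms add up to second moments of \<open>K\<close> in the two Gibbs states, whose
total weight is \<open>1 + 2 = 3\<close>. The shift by \<open>c\<close> is free because both states have trace one.
\<close>

lemma bregman_le_spread:
  fixes P Q :: "real^'n^'n"
  assumes P: "symmetric_mat P" and Q: "symmetric_mat Q"
    and R: "\<And>x. (norm ((Q - P - c *\<^sub>R mat 1) *v x))\<^sup>2 \<le> R * (norm x)\<^sup>2"
  shows "bregman P Q \<le> R / 2"
proof -
  obtain u a where u: "orthonormal_frame u" and Pa: "P = frame_diag u a"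
    using symmetric_mat_diagonalizable[OF P] .
  obtain v b where v: "orthonormal_frame v" and Qb: "Q = frame_diag v b"
    using symmetric_mat_diagonalizable[OF Q] .
  define K where "K = Q - P - c *\<^sub>R mat 1"
  define p where "p = (\<lambda>i. exp (a i - log_partition P))"
  define q where "q = (\<lambda>j. exp (b j - log_partition Q))"
  let ?s = "\<lambda>i j. u i \<bullet> v j" and ?k = "\<lambda>i j. u i \<bullet> (K *v v j)"
  have K: "symmetric_mat K"
    unfolding K_def by (intro symmetric_mat_shift symmetric_mat_diff P Q)
  have gP: "gibbs P = frame_diag u p" and gQ: "gibbs Q = frame_diag v q"
    by (simp_all add: Pa Qb p_def q_def gibbs_frame_diag[OF u] gibbs_frame_diag[OF v])
  have p: "(\<Sum>i\<in>UNIV. p i) = 1" and q: "(\<Sum>j\<in>UNIV. q j) = 1"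
    using trace_gibbs[OF P] trace_gibbs[OF Q]
    by (simp_all add: gP gQ trace_frame_diag[OF u] trace_frame_diag[OF v])
  have pos: "p i > 0" "q j > 0" for i j by (simp_all add: p_def q_def)
  have k_sym: "?k i j = v j \<bullet> (K *v u i)" for i j
    using symmetric_mat_inner[OF K, of "u i" "v j"] by (simp add: inner_commute)
  have "trace (K ** gibbs Q) = (\<Sum>j\<in>UNIV. q j * (\<Sum>i\<in>UNIV. ?s i j * ?k i j))"
    by (simp add: gQ trace_mult_frame_diag frame_parseval[OF u])
  also have "\<dots> = (\<Sum>i\<in>UNIV. \<Sum>j\<in>UNIV. ?s i j * ?k i j * q j)"
    by (subst sum.swap) (simp add: sum_distrib_left sum_distrib_right ac_simps)
  finally have trQ: "trace (K ** gibbs Q) = (\<Sum>i\<in>UNIV. \<Sum>j\<in>UNIV. ?s i j * ?k i j * q j)" .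
  have "trace (K ** gibbs P) = (\<Sum>i\<in>UNIV. p i * (\<Sum>j\<in>UNIV. (v j \<bullet> u i) * (v j \<bullet> (K *v u i))))"
    by (simp add: gP trace_mult_frame_diag frame_parseval[OF v])
  then have trP: "trace (K ** gibbs P) = (\<Sum>i\<in>UNIV. \<Sum>j\<in>UNIV. ?s i j * ?k i j * p i)"
    by (simp add: k_sym inner_commute sum_distrib_left ac_simps)
  have "bregman P Q = trace (K ** gibbs Q) - trace (K ** gibbs P) - bregman Q P"
    using bregman_symmetrized[of P Q]
    by (simp add: K_def trace_shift_mult trace_gibbs[OF P] trace_gibbs[OF Q])
  also have "\<dots> = (\<Sum>i\<in>UNIV. \<Sum>j\<in>UNIV. ?s i j * ?k i j * (q j - p i))
      - (\<Sum>i\<in>UNIV. \<Sum>j\<in>UNIV. (?s i j)\<^sup>2 * (p i - q j - q j * ((a i - log_partition P) - (b j - log_partition Q))))"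
  proof -
    have "bregman Q P = (\<Sum>i\<in>UNIV. \<Sum>j\<in>UNIV. (?s i j)\<^sup>2
        * (p i - q j - q j * ((a i - log_partition P) - (b j - log_partition Q))))"
      unfolding bregman_double_sum[OF v u Qb Pa] p_def q_def
      by (subst sum.swap) (simp add: inner_commute)
    then show ?thesis by (simp add: trP trQ right_diff_distrib sum_subtractf)
  qed
  also have "\<dots> \<le> (\<Sum>i\<in>UNIV. \<Sum>j\<in>UNIV. (?k i j)\<^sup>2 * (q j + 2 * p i) / 6)"
    unfolding sum_subtractf[symmetric]
  proof (intro sum_mono)
    fix i j
    have w: "q j + 2 * p i > 0" using pos by (simp add: add_pos_pos)
    have "3 * (q j - p i)\<^sup>2 / (2 * (q j + 2 * p i))
        \<le> p i - q j - q j * ((a i - log_partition P) - (b j - log_partition Q))"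
      unfolding p_def q_def by (rule exp_tangent_gap_ge)
    then have "(?s i j)\<^sup>2 * (3 * (q j - p i)\<^sup>2 / (2 * (q j + 2 * p i)))
        \<le> (?s i j)\<^sup>2 * (p i - q j - q j * ((a i - log_partition P) - (b j - log_partition Q)))"
      by (rule mult_left_mono) simp
    moreover have "(?s i j * (q j - p i)) * ?k i j - 3 * (?s i j * (q j - p i))\<^sup>2 / (2 * (q j + 2 * p i))
        \<le> (?k i j)\<^sup>2 * (q j + 2 * p i) / 6"
      by (rule weighted_young[OF w])
    ultimately show "?s i j * ?k i j * (q j - p i)
        - (?s i j)\<^sup>2 * (p i - q j - q j * ((a i - log_partition P) - (b j - log_partition Q)))
        \<le> (?k i j)\<^sup>2 * (q j + 2 * p i) / 6"
      by (simp add: power_mult_distrib ac_simps)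
  qed
  also have "\<dots> = ((\<Sum>i\<in>UNIV. \<Sum>j\<in>UNIV. (?k i j)\<^sup>2 * q j) + 2 * (\<Sum>i\<in>UNIV. \<Sum>j\<in>UNIV. (?k i j)\<^sup>2 * p i)) / 6"
    unfolding sum_distrib_left sum_divide_distrib sum.distrib[symmetric]
    by (intro sum.cong refl) (simp add: algebra_simps)
  also have "\<dots> \<le> (R + 2 * R) / 6"
  proof -
    have "(\<Sum>i\<in>UNIV. \<Sum>j\<in>UNIV. (?k i j)\<^sup>2 * q j) = (\<Sum>j\<in>UNIV. (norm (K *v v j))\<^sup>2 * q j)"
      by (subst sum.swap) (simp add: frame_norm[OF u] flip: sum_distrib_right)
    also have "\<dots> \<le> (\<Sum>j\<in>UNIV. R * q j)"
    proof (intro sum_mono mult_right_mono)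
      show "(norm (K *v v j))\<^sup>2 \<le> R" for j
        using R[of "v j"] by (simp add: K_def frame_unit[OF v])
    qed (use pos in \<open>simp add: less_imp_le\<close>)
    finally have 1: "(\<Sum>i\<in>UNIV. \<Sum>j\<in>UNIV. (?k i j)\<^sup>2 * q j) \<le> R"
      using q by (simp flip: sum_distrib_left)
    have "(\<Sum>i\<in>UNIV. \<Sum>j\<in>UNIV. (?k i j)\<^sup>2 * p i) = (\<Sum>i\<in>UNIV. (norm (K *v u i))\<^sup>2 * p i)"
      by (simp add: k_sym frame_norm[OF v] flip: sum_distrib_right)
    also have "\<dots> \<le> (\<Sum>i\<in>UNIV. R * p i)"
    proof (intro sum_mono mult_right_mono)
      show "(norm (K *v u i))\<^sup>2 \<le> R" for i
        using R[of "u i"] by (simp add: K_def frame_unit[OF u])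
    qed (use pos in \<open>simp add: less_imp_le\<close>)
    finally have 2: "(\<Sum>i\<in>UNIV. \<Sum>j\<in>UNIV. (?k i j)\<^sup>2 * p i) \<le> R"
      using p by (simp flip: sum_distrib_left)
    from 1 2 show ?thesis by simp
  qed
  finally show ?thesis by simp
qed

section \<open>Spectral bounds in terms of the Frobenius norm\<close>

text \<open>
Two eigenvalues are at most \<open>\<surd>2\<close> times the Frobenius norm apart. This is the source of every
\<open>\<surd>2\<close> in the convergence bound, and of the step length \<open>2\<close>.
\<close>

lemma gap_sq_le:
  fixes h :: "'n::finite \<Rightarrow> real"
  shows "(h i - h k)\<^sup>2 \<le> 2 * (\<Sum>j\<in>UNIV. (h j)\<^sup>2)"
proof (cases "i = k")
  case False
  have "(h i - h k)\<^sup>2 \<le> 2 * ((h i)\<^sup>2 + (h k)\<^sup>2)"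
    using zero_le_power2[of "h i + h k"] by (simp add: power2_eq_square algebra_simps)
  also have "(h i)\<^sup>2 + (h k)\<^sup>2 = (\<Sum>j\<in>{i, k}. (h j)\<^sup>2)" using False by simp
  also have "\<dots> \<le> (\<Sum>j\<in>UNIV. (h j)\<^sup>2)" by (intro sum_mono2) auto
  finally show ?thesis by simp
qed (simp add: sum_nonneg)

lemma centered_norm_le:
  fixes H :: "real^'n^'n"
  assumes "symmetric_mat H"
  obtains c where "\<And>x. (norm ((H - c *\<^sub>R mat 1) *v x))\<^sup>2 \<le> trace (H ** H) / 2 * (norm x)\<^sup>2"
proof -
  obtain u h where u: "orthonormal_frame u" and H: "H = frame_diag u h"
    using symmetric_mat_diagonalizable[OF assms] .
  have "Max (range h) \<in> range h" by (rule Max_in) auto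
  then obtain i where "Max (range h) = h i" by (rule rangeE)
  then have i: "h j \<le> h i" for j by (metis Max_ge finite finite_imageI rangeI)
  have "Min (range h) \<in> range h" by (rule Min_in) auto
  then obtain k where "Min (range h) = h k" by (rule rangeE)
  then have k: "h k \<le> h j" for j by (metis Min_le finite finite_imageI rangeI)
  \<comment> \<open>the midpoint of the spectrum makes the largest deviation half of the spread\<close>
  define c where "c = (h i + h k) / 2"
  have tr: "trace (H ** H) = (\<Sum>j\<in>UNIV. (h j)\<^sup>2)"
    by (simp add: H frame_diag_mult[OF u] trace_frame_diag[OF u] power2_eq_square)
  have dev: "(h j - c)\<^sup>2 \<le> trace (H ** H) / 2" for j
  proof -
    have "\<bar>h j - c\<bar> \<le> \<bar>(h i - h k) / 2\<bar>"
      using i[of j] k[of j] by (simp add: c_def abs_if field_simps)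
    then have "(h j - c)\<^sup>2 \<le> ((h i - h k) / 2)\<^sup>2" by (simp only: abs_le_square_iff)
    also have "\<dots> \<le> trace (H ** H) / 2"
      using gap_sq_le[of h i k] by (simp add: tr power_divide)
    finally show ?thesis .
  qed
  have centered: "H - c *\<^sub>R mat 1 = frame_diag u (\<lambda>j. h j - c)"
    by (rule matrix_eq_on_frame[OF u])
      (simp add: H matrix_vector_mult_diff_rdistrib frame_diag_eigenvector[OF u] scaleR_diff_left
        flip: scaleR_matrix_vector_assoc)
  have "(norm ((H - c *\<^sub>R mat 1) *v x))\<^sup>2 \<le> trace (H ** H) / 2 * (norm x)\<^sup>2" for x
  proof -
    have coord: "u j \<bullet> (frame_diag u (\<lambda>j. h j - c) *v x) = (h j - c) * (u j \<bullet> x)" for j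
    proof -
      have "u j \<bullet> (frame_diag u (\<lambda>j. h j - c) *v x)
          = (\<Sum>m\<in>UNIV. if m = j then (h m - c) * (u m \<bullet> x) else 0)"
        using u unfolding frame_diag_mult_vector inner_sum_right
        by (intro sum.cong refl) (simp add: orthonormal_frame_def)
      then show ?thesis by simp
    qed
    have "(norm ((H - c *\<^sub>R mat 1) *v x))\<^sup>2 = (\<Sum>j\<in>UNIV. (h j - c)\<^sup>2 * (u j \<bullet> x)\<^sup>2)"
      unfolding centered frame_norm[OF u, symmetric] coord by (simp add: power_mult_distrib)
    also have "\<dots> \<le> (\<Sum>j\<in>UNIV. trace (H ** H) / 2 * (u j \<bullet> x)\<^sup>2)"
      by (intro sum_mono mult_right_mono dev) simp
    also have "\<dots> = trace (H ** H) / 2 * (norm x)\<^sup>2"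
      by (simp only: frame_norm[OF u] flip: sum_distrib_left)
    finally show ?thesis .
  qed
  then show ?thesis using that by blast
qed

text \<open>
The weights of the Gibbs state are the \<open>exp (a i)\<close> divided by the partition function, which is a sum
of \<open>n\<close> terms. By the bound on the gaps each of them is at most \<open>exp (a i + \<surd>2 \<parallel>P\<parallel>)\<close>.
\<close>

lemma gibbs_ge:
  fixes P :: "real^'n^'n"
  assumes "symmetric_mat P"
  shows "exp (- sqrt 2 * sqrt (trace (P ** P))) / real CARD('n) * (norm x)\<^sup>2 \<le> x \<bullet> (gibbs P *v x)"
proof -
  obtain u a where u: "orthonormal_frame u" and P: "P = frame_diag u a"
    using symmetric_mat_diagonalizable[OF assms] .
  define D where "D = sqrt 2 * sqrt (trace (P ** P))"
  have tr: "trace (P ** P) = (\<Sum>j\<in>UNIV. (a j)\<^sup>2)"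
    by (simp add: P frame_diag_mult[OF u] trace_frame_diag[OF u] power2_eq_square)
  have gap: "a k - a i \<le> D" for i k
  proof -
    have "(a k - a i)\<^sup>2 \<le> 2 * trace (P ** P)" using gap_sq_le[of a k i] by (simp add: tr)
    then have "a k - a i \<le> sqrt (2 * trace (P ** P))" by (rule real_le_rsqrt)
    then show ?thesis by (simp add: D_def real_sqrt_mult)
  qed
  have eig: "exp (- D) / real CARD('n) \<le> exp (a i - log_partition P)" for i
  proof -
    have "(\<Sum>k\<in>UNIV. exp (a k)) \<le> (\<Sum>k\<in>(UNIV::'n set). exp (a i + D))"
    proof (rule sum_mono)
      show "exp (a k) \<le> exp (a i + D)" for k using gap[of k i] by simp
    qed
    then have "exp (log_partition P) \<le> real CARD('n) * exp (a i + D)"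
      by (simp add: P exp_log_partition[OF u])
    then show ?thesis by (simp add: exp_diff exp_minus exp_add field_simps)
  qed
  have "exp (- D) / real CARD('n) * (norm x)\<^sup>2 = (\<Sum>i\<in>UNIV. exp (- D) / real CARD('n) * (u i \<bullet> x)\<^sup>2)"
    by (simp only: frame_norm[OF u] flip: sum_distrib_left)
  also have "\<dots> \<le> (\<Sum>i\<in>UNIV. exp (a i - log_partition P) * (u i \<bullet> x)\<^sup>2)"
    by (intro sum_mono mult_right_mono eig) simp
  also have "\<dots> = x \<bullet> (gibbs P *v x)"
    by (simp add: P gibbs_frame_diag[OF u] frame_diag_mult_vector inner_sum_right
        power2_eq_square inner_commute ac_simps)
  finally show ?thesis by (simp add: D_def)
qed

text \<open>
The left side is a weighted mean of the eigenvalues of \<open>P\<close>, each of which is at most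
\<open>log tr exp P\<close>.
\<close>

lemma trace_le_log_partition:
  fixes P X :: "real^'n^'n"
  assumes P: "symmetric_mat P" and X: "X \<in> spectraplex"
  shows "trace (P ** X) \<le> log_partition P"
proof -
  obtain u a where u: "orthonormal_frame u" and Pa: "P = frame_diag u a"
    using symmetric_mat_diagonalizable[OF P] .
  have le: "a i \<le> log_partition P" for i
  proof -
    have "exp (a i) \<le> (\<Sum>k\<in>UNIV. exp (a k))" by (rule member_le_sum) auto
    then have "exp (a i) \<le> exp (log_partition P)" by (simp add: Pa exp_log_partition[OF u])
    then show ?thesis by simp
  qed
  have "trace (P ** X) = (\<Sum>i\<in>UNIV. a i * (u i \<bullet> (X *v u i)))"
    unfolding trace_mul_sym[of P X] by (simp add: Pa trace_mult_frame_diag)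
  also have "\<dots> \<le> (\<Sum>i\<in>UNIV. log_partition P * (u i \<bullet> (X *v u i)))"
    using X by (intro sum_mono mult_right_mono le) (simp add: spectraplex_def psd_def)
  also have "\<dots> = log_partition P"
    using X by (simp add: spectraplex_def flip: sum_distrib_left trace_eq_frame_sum[OF u])
  finally show ?thesis .
qed

lemma log_partition_0: "log_partition (0 :: real^'n^'n) = ln (real CARD('n))"
proof -
  have "symmetric_mat (0 :: real^'n^'n)" by (simp add: symmetric_mat_def transpose_def vec_eq_iff)
  then obtain u :: "'n \<Rightarrow> real^'n" and a where u: "orthonormal_frame u" and 0: "0 = frame_diag u a"
    using symmetric_mat_diagonalizable by metis
  have "a i = 0" for i
    using frame_diag_eigenvector[OF u, of a i] frame_unit(1)[OF u, of i] by (auto simp flip: 0)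
  then have "exp (log_partition (0 :: real^'n^'n)) = real CARD('n)"
    by (simp add: 0 exp_log_partition[OF u])
  then show ?thesis by (metis ln_exp)
qed

section \<open>The potential of an orthonormal traceless pencil\<close>

text \<open>
For such a pencil, \<open>y \<mapsto> A(y)\<close> is an isometry from the Euclidean norm to the Frobenius norm, so the
bounds of the previous parts become bounds in terms of \<open>norm y\<close>.
\<close>

locale orthonormal_pencil =
  fixes A :: "'m::finite \<Rightarrow> real^'n^'n"
  assumes A_symmetric: "symmetric_mat (A i)"
    and A_traceless: "trace (A i) = 0"
    and A_orthonormal: "trace (A i ** A j) = (if i = j then 1 else 0)"
begin

lemma trace_lin_pencil_mult: "trace (lin_pencil A y ** X) = y \<bullet> moment_map A X"
proof -
  have lin: "linear (\<lambda>B :: real^'n^'n. trace (B ** X))"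
    by (rule linearI)
      (simp_all add: trace_def matrix_matrix_mult_def distrib_right sum.distrib sum_distrib_left mult.assoc)
  show ?thesis
    unfolding lin_pencil_def
    by (simp add: linear_sum[OF lin] linear_cmul[OF lin] moment_map_def inner_vec_def)
qed

lemma trace_lin_pencil: "trace (lin_pencil A y) = 0"
  using trace_lin_pencil_mult[of y "mat 1"] by (simp add: moment_map_def A_traceless inner_vec_def)

lemma trace_lin_pencil_lin_pencil: "trace (lin_pencil A y ** lin_pencil A z) = y \<bullet> z"
proof -
  have "trace (A i ** lin_pencil A z) = z $ i" for i
    unfolding trace_mul_sym[of "A i"] trace_lin_pencil_mult
    by (simp add: moment_map_def inner_vec_def A_orthonormal if_distrib cong: if_cong)
  then show ?thesis by (simp add: trace_lin_pencil_mult moment_map_def inner_vec_def)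
qed

lemma symmetric_lin_pencil: "symmetric_mat (lin_pencil A y)"
  using A_symmetric by (simp add: symmetric_mat_def transpose_def vec_eq_iff lin_pencil_def)

lemma lin_pencil_diff: "lin_pencil A z - lin_pencil A y = lin_pencil A (z - y)"
  by (simp add: lin_pencil_def scaleR_diff_left sum_subtractf)

definition potential_grad :: "real^'m \<Rightarrow> real^'m \<Rightarrow> real^'m" where
  "potential_grad b y = moment_map A (gibbs (lin_pencil A y)) - b"

lemma potential_eq: "potential A b y = log_partition (lin_pencil A y) - b \<bullet> y"
  by (simp add: potential_def log_partition_def)

lemma potential_tangent_gap:
  "potential A b z - potential A b y - potential_grad b y \<bullet> (z - y)
    = bregman (lin_pencil A y) (lin_pencil A z)"
  by (simp add: potential_eq bregman_def potential_grad_def lin_pencil_diff trace_lin_pencil_mult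
      inner_diff_left inner_diff_right inner_commute)

lemma potential_smooth:
  "potential A b z \<le> potential A b y + potential_grad b y \<bullet> (z - y) + (norm (z - y))\<^sup>2 / 4"
proof -
  obtain c where c: "\<And>x. (norm ((lin_pencil A (z - y) - c *\<^sub>R mat 1) *v x))\<^sup>2
      \<le> (norm (z - y))\<^sup>2 / 2 * (norm x)\<^sup>2"
    using centered_norm_le[OF symmetric_lin_pencil[of "z - y"]]
    unfolding trace_lin_pencil_lin_pencil dot_square_norm by metis
  have "bregman (lin_pencil A y) (lin_pencil A z) \<le> (norm (z - y))\<^sup>2 / 2 / 2"
    by (rule bregman_le_spread[OF symmetric_lin_pencil symmetric_lin_pencil, where c = c])
      (simp only: lin_pencil_diff c)
  then show ?thesis using potential_tangent_gap[of b z y] by simp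
qed

text \<open>
On a ball of radius \<open>r\<close> all Gibbs states have their spectrum above \<open>exp (- \<surd>2 r) / n\<close>, which
therefore is a modulus of strong convexity there.
\<close>

lemma potential_strongly_convex:
  assumes "norm y \<le> r" "norm z \<le> r"
  shows "potential A b y + potential_grad b y \<bullet> (z - y)
      + exp (- sqrt 2 * r) / real CARD('n) / 2 * (norm (z - y))\<^sup>2 \<le> potential A b z"
proof -
  define \<mu> where "\<mu> = exp (- sqrt 2 * r) / real CARD('n)"
  have ge: "\<mu> * (norm x)\<^sup>2 \<le> x \<bullet> (gibbs (lin_pencil A w) *v x)" if "norm w \<le> r" for x w
  proof -
    have "\<mu> \<le> exp (- sqrt 2 * norm w) / real CARD('n)"
      unfolding \<mu>_def using that by (intro divide_right_mono) (auto simp: mult_left_mono)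
    then have "\<mu> * (norm x)\<^sup>2 \<le> exp (- sqrt 2 * norm w) / real CARD('n) * (norm x)\<^sup>2"
      by (rule mult_right_mono) simp
    also have "\<dots> \<le> x \<bullet> (gibbs (lin_pencil A w) *v x)"
      using gibbs_ge[OF symmetric_lin_pencil[of w], of x]
      by (simp add: trace_lin_pencil_lin_pencil norm_eq_sqrt_inner)
    finally show ?thesis .
  qed
  have "\<mu> / 2 * trace ((lin_pencil A z - lin_pencil A y) ** (lin_pencil A z - lin_pencil A y))
      \<le> bregman (lin_pencil A y) (lin_pencil A z)"
    by (rule bregman_ge_norm)
      (simp_all add: symmetric_lin_pencil trace_lin_pencil ge assms, simp add: \<mu>_def)
  then have "\<mu> / 2 * (norm (z - y))\<^sup>2 \<le> bregman (lin_pencil A y) (lin_pencil A z)"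
    by (simp add: lin_pencil_diff trace_lin_pencil_lin_pencil dot_square_norm)
  then show ?thesis using potential_tangent_gap[of b z y] by (simp add: \<mu>_def)
qed

text \<open>
The two preceding bounds squeeze the error of the linear approximation between \<open>0\<close> and
\<open>\<parallel>h\<parallel>\<^sup>2 / 4\<close>, which proves differentiability and identifies the gradient at once.
\<close>

lemma gradient_potential: "gradient (potential A b) y = potential_grad b y"
proof -
  let ?f = "potential A b" and ?g = "potential_grad b y"
  have bound: "norm (norm (?f (y + h) - ?f y - h \<bullet> ?g) / norm h) \<le> norm h / 4" for h
  proof -
    have "?f y + ?g \<bullet> h + 0 \<le> ?f (y + h)"
    proof -
      have "0 \<le> exp (- sqrt 2 * max (norm y) (norm (y + h))) / real CARD('n) / 2 * (norm h)\<^sup>2"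
        by simp
      then show ?thesis
        using potential_strongly_convex[of y "max (norm y) (norm (y + h))" "y + h" b]
        unfolding add_diff_cancel_left' by linarith
    qed
    moreover have "?f (y + h) \<le> ?f y + ?g \<bullet> h + (norm h)\<^sup>2 / 4"
      using potential_smooth[of b "y + h" y] by simp
    ultimately have "\<bar>?f (y + h) - ?f y - h \<bullet> ?g\<bar> \<le> norm h * (norm h / 4)"
      by (simp add: inner_commute power2_eq_square)
    then show ?thesis by (cases "h = 0") (simp_all add: divide_le_eq mult.commute)
  qed
  have "((\<lambda>h. norm (?f (y + h) - ?f y - h \<bullet> ?g) / norm h) \<longlongrightarrow> 0) (at 0)"
  proof (rule Lim_null_comparison)
    show "\<forall>\<^sub>F h in at 0. norm (norm (?f (y + h) - ?f y - h \<bullet> ?g) / norm h) \<le> norm h / 4"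
      using bound by simp
    show "((\<lambda>h :: real^'m. norm h / 4) \<longlongrightarrow> 0) (at 0)"
      by (auto intro!: tendsto_eq_intros)
  qed
  then have deriv: "GDERIV ?f y :> ?g"
    by (simp add: gderiv_def has_derivative_at bounded_linear_inner_left)
  then show ?thesis
    unfolding gradient_def
  proof (rule the_equality)
    fix D assume "GDERIV ?f y :> D"
    then have "(\<lambda>h. h \<bullet> D) = (\<lambda>h. h \<bullet> ?g)"
      using deriv unfolding gderiv_def by (rule has_derivative_unique)
    then show "D = ?g" by (metis vector_eq_ldot)
  qed
qed

lemma moment_body_support:
  assumes "p \<in> moment_body A"
  shows "p \<bullet> y \<le> log_partition (lin_pencil A y)"
  using assms trace_le_log_partition[OF symmetric_lin_pencil[of y]]
  by (auto simp: moment_body_def trace_lin_pencil_mult inner_commute)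

text \<open>
The distance to an empty set is \<open>0\<close> by convention, so the boundary has to be shown nonempty:
the support bound keeps the moment body from being the whole space.
\<close>

lemma infdist_frontier_moment_body_pos:
  assumes b: "b \<in> interior (moment_body A)"
  shows "0 < infdist b (frontier (moment_body A))"
proof -
  obtain e :: "real^'m" where e: "norm e = 1"
    using norm_axis_1 by blast
  have "moment_body A \<noteq> UNIV"
  proof
    assume "moment_body A = UNIV"
    then have "((log_partition (lin_pencil A e) + 1) *\<^sub>R e) \<bullet> e \<le> log_partition (lin_pencil A e)"
      by (intro moment_body_support) simp
    then show False using e by (simp add: dot_square_norm)
  qed
  then have "frontier (moment_body A) \<noteq> {}"
    using b interior_subset by (auto simp: frontier_eq_empty)
  moreover have "b \<notin> frontier (moment_body A)" using b by (simp add: frontier_def)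
  ultimately show ?thesis by (simp add: infdist_pos_not_in_closed)
qed

lemma ball_subset_moment_body:
  assumes b: "b \<in> interior (moment_body A)"
  shows "ball b (infdist b (frontier (moment_body A))) \<subseteq> moment_body A"
proof (rule ccontr)
  let ?d = "infdist b (frontier (moment_body A))"
  assume "\<not> ball b ?d \<subseteq> moment_body A"
  moreover have "b \<in> ball b ?d \<inter> moment_body A"
    using b interior_subset infdist_frontier_moment_body_pos[OF b] by auto
  then have "ball b ?d \<inter> moment_body A \<noteq> {}" by blast
  ultimately have "ball b ?d \<inter> frontier (moment_body A) \<noteq> {}"
    by (intro connected_Int_frontier connected_ball) auto
  then obtain x where "x \<in> frontier (moment_body A)" "dist b x < ?d" by auto
  then show False using infdist_le[of x _ b] by fastforce
qed

text \<open>
The moment body contains the points \<open>b + t y / \<parallel>y\<parallel>\<close> for \<open>t\<close> below the boundary distance, and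
\<open>log tr exp A(y)\<close> dominates their inner products with \<open>y\<close>.
\<close>

lemma potential_coercive:
  assumes b: "b \<in> interior (moment_body A)"
  shows "infdist b (frontier (moment_body A)) * norm y \<le> potential A b y"
proof (cases "y = 0")
  case True
  have "lin_pencil A 0 = 0" by (simp add: lin_pencil_def)
  then show ?thesis using True by (simp add: potential_eq log_partition_0)
next
  case False
  let ?d = "infdist b (frontier (moment_body A))"
  have "t \<le> potential A b y / norm y" if t: "0 < t" "t < ?d" for t
  proof -
    have "b + (t / norm y) *\<^sub>R y \<in> ball b ?d" using t False by (simp add: dist_norm)
    then have "b + (t / norm y) *\<^sub>R y \<in> moment_body A" using ball_subset_moment_body[OF b] by blast
    from moment_body_support[OF this, of y] show ?thesis
      using False by (simp add: inner_add_left dot_square_norm power2_eq_square potential_eq field_simps)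
  qed
  then have "?d \<le> potential A b y / norm y"
    by (rule dense_le_bounded[OF infdist_frontier_moment_body_pos[OF b]])
  then show ?thesis using False by (simp add: field_simps)
qed

end

section \<open>Linear convergence of the gradient method\<close>

text \<open>
The step \<open>2\<close> minimizes the quadratic upper model and lowers \<open>f\<close> by at least \<open>\<parallel>g\<parallel>\<^sup>2\<close>. Strong
convexity on the sublevel set bounds \<open>\<parallel>g\<parallel>\<^sup>2\<close> below by \<open>2 \<mu>\<close> times the gap to any value \<open>f w\<close>
attained there, so this gap contracts by \<open>1 - 2 \<mu>\<close> in every step. The comparison point
is the iterate \<open>w\<close> that follows \<open>y k\<close>, rather than a minimizer: by the descent property the gap
\<open>f (y k) - f w\<close> already bounds \<open>\<parallel>g (y k)\<parallel>\<^sup>2\<close>.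
\<close>

lemma gradient_descent_linear_rate:
  fixes f :: "'a::real_inner \<Rightarrow> real" and g :: "'a \<Rightarrow> 'a" and y :: "nat \<Rightarrow> 'a"
  assumes step: "\<And>k. y (Suc k) = y k - 2 *\<^sub>R g (y k)"
    and smooth: "\<And>x z. f z \<le> f x + g x \<bullet> (z - x) + (norm (z - x))\<^sup>2 / 4"
    and convex: "\<And>x z. f x \<le> f (y 0) \<Longrightarrow> f z \<le> f (y 0) \<Longrightarrow>
      f x + g x \<bullet> (z - x) + \<mu> / 2 * (norm (z - x))\<^sup>2 \<le> f z"
    and mu: "0 < \<mu>" "\<mu> \<le> 1 / 2" and nonneg: "\<And>x. 0 \<le> f x"
  shows "(norm (g (y k)))\<^sup>2 \<le> (1 - 2 * \<mu>) ^ k * f (y 0)"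
proof -
  have descent: "f (y (Suc j)) \<le> f (y j) - (norm (g (y j)))\<^sup>2" for j
    using smooth[of "y (Suc j)" "y j"] by (simp add: step dot_square_norm power_mult_distrib)
  then have decr: "f (y (Suc j)) \<le> f (y j)" for j
    by (rule order_trans) simp
  have sublevel: "f (y j) \<le> f (y 0)" for j
    by (rule lift_Suc_antimono_le[of "\<lambda>j. f (y j)", OF decr]) simp
  define w where "w = y (Suc k)"
  have gradient_dominance: "2 * \<mu> * (f (y j) - f w) \<le> (norm (g (y j)))\<^sup>2" for j
  proof -
    \<comment> \<open>minimizing the quadratic lower model over its argument, as a completed square\<close>
    have "0 \<le> (norm (g (y j) + \<mu> *\<^sub>R (w - y j)))\<^sup>2" by simp
    also have "\<dots> = (norm (g (y j)))\<^sup>2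
        + 2 * \<mu> * (g (y j) \<bullet> (w - y j) + \<mu> / 2 * (norm (w - y j))\<^sup>2)"
      unfolding power2_norm_eq_inner inner_add_left inner_add_right inner_scaleR_left inner_scaleR_right
        inner_commute[of "w - y j" "g (y j)"]
      by algebra
    also have "\<dots> \<le> (norm (g (y j)))\<^sup>2 + 2 * \<mu> * (f w - f (y j))"
      using convex[of "y j" w] sublevel[of j] sublevel[of "Suc k"] mu by (simp add: w_def)
    finally show ?thesis by (simp add: algebra_simps)
  qed
  have rate: "f (y j) - f w \<le> (1 - 2 * \<mu>) ^ j * (f (y 0) - f w)" for j
  proof (induction j)
    case (Suc j)
    have "f (y (Suc j)) - f w \<le> (1 - 2 * \<mu>) * (f (y j) - f w)"
      using descent[of j] gradient_dominance[of j] by (simp add: algebra_simps)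
    also have "\<dots> \<le> (1 - 2 * \<mu>) * ((1 - 2 * \<mu>) ^ j * (f (y 0) - f w))"
      using Suc mu by (intro mult_left_mono) auto
    finally show ?case by simp
  qed simp
  have "(norm (g (y k)))\<^sup>2 \<le> f (y k) - f w" using descent[of k] by (simp add: w_def)
  also have "\<dots> \<le> (1 - 2 * \<mu>) ^ k * (f (y 0) - f w)" by (rule rate)
  also have "\<dots> \<le> (1 - 2 * \<mu>) ^ k * f (y 0)"
    using mu nonneg[of w] by (intro mult_left_mono) auto
  finally show ?thesis .
qed

lemma norm_le_of_linear_rate:
  fixes G F \<mu> \<epsilon> :: real
  assumes rate: "G\<^sup>2 \<le> (1 - 2 * \<mu>) ^ k * F" and mu: "0 < \<mu>" "\<mu> \<le> 1 / 2"
    and pos: "0 < F" "0 < \<epsilon>" and k: "1 / \<mu> * ln (sqrt F / \<epsilon>) \<le> real k"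
  shows "G \<le> \<epsilon>"
proof -
  have "(1 - 2 * \<mu>) ^ k \<le> exp (- 2 * \<mu>) ^ k"
    using mu exp_ge_add_one_self[of "- 2 * \<mu>"] by (intro power_mono) auto
  also have "\<dots> = exp (2 * - (\<mu> * real k))"
    by (subst exp_of_nat_mult[symmetric]) (simp add: mult.commute mult.left_commute)
  also have "\<dots> = (exp (- (\<mu> * real k)))\<^sup>2"
    by (rule exp_double)
  finally have "(1 - 2 * \<mu>) ^ k * F \<le> (exp (- (\<mu> * real k)))\<^sup>2 * F"
    by (rule mult_right_mono) (simp add: pos less_imp_le)
  with rate have "G\<^sup>2 \<le> (exp (- (\<mu> * real k)))\<^sup>2 * F"
    by (rule order_trans)
  also have "\<dots> = (exp (- (\<mu> * real k)) * sqrt F)\<^sup>2" using pos by (simp add: power_mult_distrib)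
  finally have "G \<le> exp (- (\<mu> * real k)) * sqrt F" by (rule power2_le_imp_le) (simp add: pos less_imp_le)
  also have "\<dots> \<le> \<epsilon>"
  proof -
    have "ln (sqrt F / \<epsilon>) = \<mu> * (1 / \<mu> * ln (sqrt F / \<epsilon>))" using mu by simp
    also have "\<dots> \<le> \<mu> * real k" using k mu by (intro mult_left_mono) auto
    finally have "exp (ln (sqrt F / \<epsilon>)) \<le> exp (\<mu> * real k)" by simp
    then have "sqrt F / \<epsilon> \<le> exp (\<mu> * real k)" using pos by simp
    then have "sqrt F \<le> exp (\<mu> * real k) * \<epsilon>" using pos by (simp add: pos_divide_le_eq)
    then show ?thesis
      by (simp add: exp_minus inverse_eq_divide pos_divide_le_eq mult.commute)
  qed
  finally show ?thesis .
qed

theorem theorem5: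
  fixes A :: "'m::finite \<Rightarrow> real^'n^'n"
    and b :: "real^'m"
    and y :: "nat \<Rightarrow> real^'m"
    and f :: "real^'m \<Rightarrow> real"
    and \<delta> \<epsilon> :: real
  assumes n_ge_2: "CARD('n) \<ge> 2"
    and A_symmetric: "\<And>i. symmetric_mat (A i)"
    and A_traceless: "\<And>i. trace (A i) = 0"
    and A_orthonormal: "\<And>i j. trace (A i ** A j) = (if i = j then 1 else 0)"
    and b_interior: "b \<in> interior (moment_body A)"
    and delta_eq: "\<delta> = infdist b (frontier (moment_body A))"
    and f_eq: "f = potential A b"
    and gradient_step: "\<And>k. y (Suc k) = y k - 2 *\<^sub>R gradient f (y k)"
    and eps_pos: "\<epsilon> > 0"
  shows "\<delta> > 0
    \<and> (\<forall>k. real k \<ge> real CARD('n) * exp (sqrt 2 * f (y 0) / \<delta>) * ln (sqrt (f (y 0)) / \<epsilon>)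
           \<longrightarrow> norm (gradient f (y k)) \<le> \<epsilon>)
    \<and> f 0 = ln (real CARD('n))
    \<and> (y 0 = 0 \<longrightarrow>
         (\<forall>k. real k \<ge> real CARD('n) powr (1 + sqrt 2 / \<delta>) * ln (sqrt (ln (real CARD('n))) / \<epsilon>)
              \<longrightarrow> norm (gradient f (y k)) \<le> \<epsilon>))"
proof -
  interpret orthonormal_pencil A
    by unfold_locales (fact A_symmetric A_traceless A_orthonormal)+
  have delta: "\<delta> > 0"
    unfolding delta_eq by (rule infdist_frontier_moment_body_pos[OF b_interior])
  have f0: "f 0 = ln (real CARD('n))"
    by (simp add: f_eq potential_eq lin_pencil_def log_partition_0)
  have grad: "gradient f = potential_grad b"
    by (rule ext) (simp add: f_eq gradient_potential)
  have coercive: "\<delta> * norm x \<le> f x" for x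
    unfolding delta_eq f_eq by (rule potential_coercive[OF b_interior])
  have nonneg: "0 \<le> f x" for x
    by (rule order_trans[OF _ coercive]) (simp add: delta less_imp_le)
  have F_pos: "0 < f (y 0)"
  proof (cases "y 0 = 0")
    case True
    then show ?thesis using f0 n_ge_2 by simp
  next
    case False
    then have "0 < \<delta> * norm (y 0)" using delta by simp
    then show ?thesis using coercive[of "y 0"] by linarith
  qed
  \<comment> \<open>coercivity puts the initial sublevel set into the ball of radius \<open>r\<close>, on which \<open>\<mu>\<close> is a
    modulus of strong convexity\<close>
  define r where "r = f (y 0) / \<delta>"
  define \<mu> where "\<mu> = exp (- sqrt 2 * r) / real CARD('n)"
  have mu: "0 < \<mu>" "\<mu> \<le> 1 / 2"
  proof -
    show "0 < \<mu>" by (simp add: \<mu>_def)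
    have "exp (- sqrt 2 * r) \<le> 1" using delta F_pos by (simp add: r_def)
    then have "\<mu> \<le> 1 / real CARD('n)" unfolding \<mu>_def by (rule divide_right_mono) simp
    also have "\<dots> \<le> 1 / 2" using n_ge_2 by (intro divide_left_mono) auto
    finally show "\<mu> \<le> 1 / 2" .
  qed
  have inverse_mu: "1 / \<mu> = real CARD('n) * exp (sqrt 2 * f (y 0) / \<delta>)"
    by (simp add: \<mu>_def r_def exp_minus field_simps)
  have radius: "norm x \<le> r" if "f x \<le> f (y 0)" for x
    using coercive[of x] that delta by (simp add: r_def field_simps)
  have rate: "(norm (gradient f (y k)))\<^sup>2 \<le> (1 - 2 * \<mu>) ^ k * f (y 0)" for k
    unfolding grad
  proof (rule gradient_descent_linear_rate[OF _ _ _ mu nonneg])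
    show "y (Suc k) = y k - 2 *\<^sub>R potential_grad b (y k)" for k
      using gradient_step[of k] by (simp add: grad)
    show "f z \<le> f x + potential_grad b x \<bullet> (z - x) + (norm (z - x))\<^sup>2 / 4" for x z
      unfolding f_eq by (rule potential_smooth)
    show "f x + potential_grad b x \<bullet> (z - x) + \<mu> / 2 * (norm (z - x))\<^sup>2 \<le> f z"
      if "f x \<le> f (y 0)" "f z \<le> f (y 0)" for x z
      using potential_strongly_convex[OF radius radius, of x z b] that by (simp add: f_eq \<mu>_def)
  qed
  have bound: "norm (gradient f (y k)) \<le> \<epsilon>"
    if "real k \<ge> real CARD('n) * exp (sqrt 2 * f (y 0) / \<delta>) * ln (sqrt (f (y 0)) / \<epsilon>)" for k
    using norm_le_of_linear_rate[OF rate mu F_pos eps_pos] that by (simp add: inverse_mu)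
  have power: "real CARD('n) powr (1 + sqrt 2 / \<delta>)
      = real CARD('n) * exp (sqrt 2 * ln (real CARD('n)) / \<delta>)"
    by (simp add: powr_def algebra_simps exp_add)
  show ?thesis
    using delta bound f0 by (auto simp: power)
qed

end
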